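(* Let $K$ be a field and $n\ge 1$. Let $F : K^n \to K^n$ be a Keller map all of whose terms have degree in $\{0, 1, d\}$, where $d > 1$ is an integer that is a unit in $K$ (i.e. its image in $K$ is nonzero). Let $a \in K^n$. Then the restriction $F|_{Ka}$ of $F$ to $Ka = \{\lambda a : \lambda \in K\}$ is injective.
   Context: A polynomial map $F : K^n \to K^n$ is a tuple $F = (F_1,\ldots,F_n)$ of polynomials $F_i \in K[x] = K[x_1,\ldots,x_n]$ (identified with the tuple of polynomials, not merely the induced function). Its Jacobian matrix is $\mathcal{J} F = \left(\frac{\partial F_i}{\partial x_j}\right)_{i,j}$ (formal partial derivatives). $F$ is called a Keller map if $\det \mathcal{J} F$ is a nonzero constant, i.e. $\det \mathcal{J}F \in K^* = K\setminus\{0\}$. A term of $F$ is a monomial occurring with nonzero coefficient in some component $F_i$; its degree is its total degree. *)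

theory Defs
  imports "HOL-Analysis.Analysis" "HOL-Library.Poly_Mapping"
begin

text \<open>The polynomial ring \<open>K[x\<^sub>i | i \<in> 'n]\<close> is the ring of finitely supported maps from
  exponent vectors to coefficients; its ring structure is the convolution product of
  \<open>Poly_Mapping\<close>, and the monomials with nonzero coefficient are the \<open>keys\<close>. No
  characteristic or infinitude assumption is made, so a polynomial is not determined by the
  function it induces.\<close>

type_synonym 'n monomial = "'n \<Rightarrow>\<^sub>0 nat"
type_synonym ('n, 'k) mpoly = "'n monomial \<Rightarrow>\<^sub>0 'k"
type_synonym ('n, 'k) poly_map = "('n, 'k) mpoly ^ 'n"

definition mdegree :: "'n::finite monomial \<Rightarrow> nat" where
  "mdegree m = (\<Sum>i\<in>UNIV. Poly_Mapping.lookup m i)"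

definition const_mpoly :: "'k::zero \<Rightarrow> ('n, 'k) mpoly" where
  "const_mpoly c = Poly_Mapping.single 0 c"

definition eval_mpoly :: "('n::finite, 'k::comm_semiring_1) mpoly \<Rightarrow> 'k ^ 'n \<Rightarrow> 'k" where
  "eval_mpoly p x =
     (\<Sum>m\<in>Poly_Mapping.keys p.
        Poly_Mapping.lookup p m * (\<Prod>i\<in>UNIV. (x $ i) ^ Poly_Mapping.lookup m i))"

text \<open>In the formal partial derivative, the truncation in the exponent \<open>m\<^sub>j - 1\<close> is harmless:
  when \<open>m\<^sub>j = 0\<close> the coefficient is \<open>0\<close>.\<close>

definition partial_deriv :: "'n \<Rightarrow> ('n, 'k::semiring_1) mpoly \<Rightarrow> ('n, 'k) mpoly" where
  "partial_deriv j p =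
     (\<Sum>m\<in>Poly_Mapping.keys p.
        Poly_Mapping.single (m - Poly_Mapping.single j 1)
          (of_nat (Poly_Mapping.lookup m j) * Poly_Mapping.lookup p m))"

definition jacobian_mat ::
    "('n::finite, 'k::semiring_1) poly_map \<Rightarrow> ('n, 'k) mpoly ^ 'n ^ 'n" where
  "jacobian_mat F = (\<chi> i j. partial_deriv j (F $ i))"

definition keller_map :: "('n::finite, 'k::field) poly_map \<Rightarrow> bool" where
  "keller_map F \<longleftrightarrow> (\<exists>c. c \<noteq> 0 \<and> det (jacobian_mat F) = const_mpoly c)"

definition poly_map_terms :: "('n::finite, 'k::zero) poly_map \<Rightarrow> 'n monomial set" where
  "poly_map_terms F = (\<Union>i. Poly_Mapping.keys (F $ i))"

definition eval_poly_map ::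
    "('n::finite, 'k::comm_semiring_1) poly_map \<Rightarrow> 'k ^ 'n \<Rightarrow> 'k ^ 'n" where
  "eval_poly_map F x = (\<chi> i. eval_mpoly (F $ i) x)"

lemma lookup_partial_deriv:
  "Poly_Mapping.lookup (partial_deriv j p) m =
     of_nat (Poly_Mapping.lookup m j + 1) * Poly_Mapping.lookup p (m + Poly_Mapping.single j 1)"
proof -
  let ?e = "Poly_Mapping.single j (1::nat)"
  have eq: "(of_nat (Poly_Mapping.lookup m' j) * Poly_Mapping.lookup p m' when m' - ?e = m) =
      (of_nat (Poly_Mapping.lookup m' j) * Poly_Mapping.lookup p m' when m' = m + ?e)" for m'
  proof (cases "Poly_Mapping.lookup m' j = 0")
    case False
    have "m' - ?e = m \<longleftrightarrow> m' = m + ?e"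
    proof
      assume "m' - ?e = m"
      then have "m + ?e = m' - ?e + ?e" by simp
      also have "\<dots> = m'"
        using False by (intro poly_mapping_eqI) (auto simp: lookup_add lookup_minus lookup_single when_def)
      finally show "m' = m + ?e" ..
    qed simp
    then show ?thesis by simp
  qed (simp add: when_def)
  have "Poly_Mapping.lookup (partial_deriv j p) m =
      (\<Sum>m'\<in>Poly_Mapping.keys p.
         of_nat (Poly_Mapping.lookup m' j) * Poly_Mapping.lookup p m' when m' = m + ?e)"
    unfolding partial_deriv_def lookup_sum lookup_single eq ..
  also have "\<dots> = of_nat (Poly_Mapping.lookup m j + 1) * Poly_Mapping.lookup p (m + ?e)"
    by (simp add: when_def sum.delta' lookup_add in_keys_iff)
  finally show ?thesis .
qed

end

theory Submission
  imports Defs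
begin

text \<open>Restrict \<open>F\<close> to the line \<open>t \<mapsto> t a\<close>: each component becomes a univariate polynomial
  \<open>\<alpha>\<^sub>i + \<beta>\<^sub>i t + \<gamma>\<^sub>i t\<^sup>d\<close>, and by the chain rule the Jacobian along the line, applied to \<open>a\<close>, is the
  vector of derivatives \<open>\<beta>\<^sub>i + d \<gamma>\<^sub>i t\<^sup>d\<^sup>-\<^sup>1\<close>. If \<open>F\<close> takes the same value at \<open>\<lambda> a\<close> and \<open>\<mu> a\<close> with
  \<open>\<lambda> \<noteq> \<mu>\<close>, then \<open>(\<lambda> - \<mu>) \<beta>\<^sub>i = - (\<lambda>\<^sup>d - \<mu>\<^sup>d) \<gamma>\<^sub>i\<close>, so all these derivatives are constant multiples of
  one polynomial of degree \<open>d - 1 > 0\<close>. By Cramer's rule over \<open>K[t]\<close> that polynomial divides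
  \<open>a\<^sub>k det JF\<close>, a nonzero constant when \<open>a\<^sub>k \<noteq> 0\<close>. Working over \<open>K[t]\<close> avoids extending \<open>K\<close> by a
  root of that polynomial.\<close>

text \<open>Expanding along row \<open>k\<close> by linearity, every summand with
  \<open>j \<noteq> k\<close> has two equal rows and vanishes.\<close>

lemma det_replace_row_lincomb:
  fixes A :: "'a::comm_ring_1^'n^'n"
  shows "det (\<chi> i. if i = k then (\<Sum>j\<in>UNIV. x $ j *s row j A) else row i A) = x $ k * det A"
proof -
  have rows: "(\<chi> i. if i = k then row k A else row i A) = A"
    by (simp add: vec_eq_iff row_def)
  have zero: "det (\<chi> i. if i = k then row j A else row i A) = 0" if "j \<noteq> k" for j
    by (rule det_identical_rows[OF that]) (use that in \<open>simp add: row_def vec_eq_iff\<close>)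
  have "det (\<chi> i. if i = k then (\<Sum>j\<in>UNIV. x $ j *s row j A) else row i A) =
      (\<Sum>j\<in>UNIV. x $ j * det (\<chi> i. if i = k then row j A else row i A))"
    by (simp add: det_linear_row_sum det_row_mul)
  also have "\<dots> = (\<Sum>j\<in>UNIV. if j = k then x $ k * det A else 0)"
    by (intro sum.cong refl) (auto simp: zero rows)
  finally show ?thesis by simp
qed

text \<open>Cramer's rule without division: \<open>x $ k * det A\<close> is the determinant of
  \<open>A\<close> with column \<open>k\<close> replaced by \<open>A *v x\<close>, and the factor
  \<open>g\<close> comes out of that column. Transposing turns columns into rows.\<close>

lemma dvd_mult_det:
  fixes A :: "'a::comm_ring_1^'n^'n"
  assumes "A *v x = g *s v"
  shows "g dvd x $ k * det A"
proof -
  let ?B = "transpose A"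
  have "(\<Sum>j\<in>UNIV. x $ j *s row j ?B) = A *v x"
    by (simp add: vec_eq_iff matrix_vector_mult_def row_def transpose_def mult.commute)
  then have "x $ k * det ?B = det (\<chi> i. if i = k then g *s v else row i ?B)"
    using det_replace_row_lincomb[of k x ?B] by (simp only: assms)
  also have "\<dots> = g * det (\<chi> i. if i = k then v else row i ?B)"
    by (rule det_row_mul)
  finally show ?thesis by simp
qed

lemma det_ring_hom:
  fixes f :: "'a::comm_ring_1 \<Rightarrow> 'b::comm_ring_1" and A :: "'a^'n^'n"
  assumes one: "f 1 = 1"
    and add: "\<And>x y. f (x + y) = f x + f y"
    and mult: "\<And>x y. f (x * y) = f x * f y"
  shows "det (\<chi> i j. f (A $ i $ j)) = f (det A)"
proof -
  have zero: "f 0 = 0"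
    using add[of 0 0] by simp
  have minus: "f (- x) = - f x" for x
    using add[of x "- x"] zero by (simp add: eq_neg_iff_add_eq_0 add.commute)
  have sum: "f (sum g S) = (\<Sum>s\<in>S. f (g s))" for g and S :: "'c set"
    by (induction S rule: infinite_finite_induct) (simp_all add: zero add)
  have prod: "f (prod g S) = (\<Prod>s\<in>S. f (g s))" for g and S :: "'c set"
    by (induction S rule: infinite_finite_induct) (simp_all add: one mult)
  have sign: "f (of_int (sign p)) = of_int (sign p)" for p :: "'n \<Rightarrow> 'n"
    by (simp add: sign_def one minus)
  show ?thesis
    by (simp add: det_def sum prod mult sign)
qed

lemma poly_mapping_add_induct [case_names zero single add]:
  assumes "P 0" and "\<And>m c. P (Poly_Mapping.single m c)"
    and "\<And>p q. P p \<Longrightarrow> P q \<Longrightarrow> P (p + q)"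
  shows "P (p :: 'a \<Rightarrow>\<^sub>0 'b::comm_monoid_add)"
proof (induction p rule: update_induct)
  case (update f a b)
  have "Poly_Mapping.update a b f = f + Poly_Mapping.single a b"
    using update(1) by (intro poly_mapping_eqI)
      (auto simp: lookup_update lookup_add lookup_single when_def in_keys_iff)
  then show ?case using assms update by simp
qed (rule assms)

definition monomial_value :: "'k::comm_semiring_1 ^ 'n \<Rightarrow> 'n::finite monomial \<Rightarrow> 'k" where
  "monomial_value a m = (\<Prod>i\<in>UNIV. (a $ i) ^ Poly_Mapping.lookup m i)"

text \<open>The substitution of \<open>a $ i\<close> times the variable for each coordinate. The
  result is a formal polynomial because over a finite field the induced function would lose
  information.\<close>

definition line_poly :: "'k::comm_semiring_1 ^ 'n \<Rightarrow> ('n::finite, 'k) mpoly \<Rightarrow> 'k poly" where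
  "line_poly a p =
     (\<Sum>m\<in>Poly_Mapping.keys p. monom (Poly_Mapping.lookup p m * monomial_value a m) (mdegree m))"

lemma mdegree_0 [simp]: "mdegree 0 = 0"
  by (simp add: mdegree_def)

lemma mdegree_add: "mdegree (m + m') = mdegree m + mdegree m'"
  by (simp add: mdegree_def lookup_add sum.distrib)

lemma mdegree_single [simp]: "mdegree (Poly_Mapping.single j k) = k"
  by (simp add: mdegree_def lookup_single when_def)

lemma monomial_value_0 [simp]: "monomial_value a 0 = 1"
  by (simp add: monomial_value_def)

lemma monomial_value_add: "monomial_value a (m + m') = monomial_value a m * monomial_value a m'"
  by (simp add: monomial_value_def lookup_add power_add prod.distrib)

lemma monomial_value_single [simp]: "monomial_value a (Poly_Mapping.single j k) = (a $ j) ^ k"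
proof -
  have "monomial_value a (Poly_Mapping.single j k) = (\<Prod>i\<in>UNIV. if i = j then (a $ j) ^ k else 1)"
    unfolding monomial_value_def by (intro prod.cong) (auto simp: lookup_single when_def)
  then show ?thesis by simp
qed

lemma monomial_value_scale: "monomial_value (c *s a) m = c ^ mdegree m * monomial_value a m"
  by (simp add: monomial_value_def mdegree_def power_mult_distrib prod.distrib power_sum)

lemma line_poly_0 [simp]: "line_poly a 0 = 0"
  by (simp add: line_poly_def)

lemma line_poly_single [simp]:
  "line_poly a (Poly_Mapping.single m c) = monom (c * monomial_value a m) (mdegree m)"
  by (cases "c = 0") (simp_all add: line_poly_def)

lemma line_poly_add: "line_poly a (p + q) = line_poly a p + line_poly a q"
  unfolding line_poly_def
  by (rule setsum_keys_plus_distrib) (simp_all add: distrib_right add_monom)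

lemma line_poly_mult: "line_poly a (p * q) = line_poly a p * line_poly a q"
proof (induction p rule: poly_mapping_add_induct)
  case (single m c)
  show ?case
    by (induction q rule: poly_mapping_add_induct)
      (simp_all add: mult_single mult_monom mdegree_add monomial_value_add line_poly_add
        distrib_left distrib_right ac_simps)
qed (simp_all add: line_poly_add distrib_right)

lemma line_poly_1 [simp]: "line_poly a 1 = 1"
  by (simp flip: single_one)

lemma poly_line_poly: "poly (line_poly a p) c = eval_mpoly p (c *s a)"
  unfolding line_poly_def eval_mpoly_def monomial_value_def[symmetric] monomial_value_scale
  by (simp add: poly_sum poly_monom ac_simps)

lemma coeff_line_poly_eq_0:
  assumes "\<And>m. m \<in> Poly_Mapping.keys p \<Longrightarrow> mdegree m \<noteq> k"
  shows "coeff (line_poly a p) k = 0"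
  using assms by (simp add: line_poly_def coeff_sum)

lemma partial_deriv_single:
  "partial_deriv j (Poly_Mapping.single m c) =
     Poly_Mapping.single (m - Poly_Mapping.single j 1) (of_nat (Poly_Mapping.lookup m j) * c)"
  by (cases "c = 0") (simp_all add: partial_deriv_def)

lemma partial_deriv_add: "partial_deriv j (p + q) = partial_deriv j p + partial_deriv j q"
  by (intro poly_mapping_eqI) (simp add: lookup_partial_deriv lookup_add distrib_left)

text \<open>The factor \<open>a $ j\<close> restores the power lost by differentiating, so nothing
  is divided by \<open>a $ j\<close>, which may be zero.\<close>

lemma line_poly_partial_deriv_monomial:
  fixes a :: "'k::comm_ring_1 ^ 'n::finite"
  shows "line_poly a (partial_deriv j (Poly_Mapping.single m c)) * [:a $ j:] =
    monom (of_nat (Poly_Mapping.lookup m j) * (c * monomial_value a m)) (mdegree m - 1)"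
proof (cases "Poly_Mapping.lookup m j = 0")
  case False
  let ?e = "Poly_Mapping.single j (1::nat)"
  have m: "m = (m - ?e) + ?e"
    using False by (intro poly_mapping_eqI) (auto simp: lookup_add lookup_minus lookup_single when_def)
  have deg: "mdegree m - 1 = mdegree (m - ?e)"
    by (subst (1) m) (simp only: mdegree_add mdegree_single)
  have val: "monomial_value a m = monomial_value a (m - ?e) * a $ j"
    by (subst (1) m) (simp only: monomial_value_add monomial_value_single power_one_right)
  show ?thesis
    by (simp add: partial_deriv_single deg[simplified] val[simplified] mult_monom ac_simps flip: monom_0)
qed (simp add: partial_deriv_single)

text \<open>The chain rule along the line. On a monomial it is Euler's identity: the exponents add
  up to the degree.\<close>

lemma pderiv_line_poly:
  fixes a :: "'k::idom ^ 'n::finite"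
  shows "(\<Sum>j\<in>UNIV. line_poly a (partial_deriv j p) * [:a $ j:]) = pderiv (line_poly a p)"
proof (induction p rule: poly_mapping_add_induct)
  case zero
  show ?case by (simp add: partial_deriv_def)
next
  case (single m c)
  show ?case
    unfolding line_poly_partial_deriv_monomial
    by (simp add: pderiv_monom mdegree_def sum_distrib_right flip: monom_sum)
next
  case (add p q)
  then show ?case
    by (simp add: partial_deriv_add line_poly_add smult_add_right sum.distrib pderiv_add)
qed

lemma poly_3_terms:
  assumes "\<And>k. k \<notin> {0, 1, d} \<Longrightarrow> coeff p k = 0" and "d > 1"
  shows "p = monom (coeff p 0) 0 + monom (coeff p 1) 1 + monom (coeff p d) d"
  by (rule poly_eqI) (use assms in auto)

text \<open>Equality of the two values determines the linear coefficient from the top one. The first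
  factor depends only on \<open>d\<close>, \<open>l\<close> and \<open>u\<close>, hence is shared by
  all components of the map.\<close>

lemma pderiv_3_terms_equal_values:
  fixes p :: "'a::field poly"
  assumes "\<And>k. k \<notin> {0, 1, d} \<Longrightarrow> coeff p k = 0" and "d > 1"
    and "poly p l = poly p u" and "l \<noteq> u"
  shows "pderiv p =
    (monom (of_nat d) (d - 1) - [:(l ^ d - u ^ d) / (l - u):]) * [:coeff p d:]"
proof -
  have p: "p = monom (coeff p 0) 0 + monom (coeff p 1) 1 + monom (coeff p d) d"
    using assms(1,2) by (rule poly_3_terms)
  have "coeff p 1 * l + coeff p d * l ^ d = coeff p 1 * u + coeff p d * u ^ d"
    using assms(3) by (subst (asm) (1 2) p) (simp add: poly_monom)
  then have "coeff p 1 = - ((l ^ d - u ^ d) / (l - u) * coeff p d)"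
    using assms(4) by (simp add: field_simps)
  moreover have "pderiv p = [:coeff p 1:] + monom (of_nat d * coeff p d) (d - 1)"
    by (subst p) (simp add: pderiv_add pderiv_monom monom_0)
  ultimately show ?thesis
    by (simp add: left_diff_distrib mult_monom minus_monom flip: monom_0)
qed

theorem proposition1p1:
  fixes F :: "('n::finite, 'k::field) poly_map"
    and d :: nat
    and a :: "'k ^ 'n"
  assumes "keller_map F"
    and "d > 1"
    and "(of_nat d :: 'k) \<noteq> 0"
    and "\<forall>m \<in> poly_map_terms F. mdegree m \<in> {0, 1, d}"
  shows "inj_on (eval_poly_map F) {c *s a | c. True}"
proof -
  have "l *s a = u *s a" if eq: "eval_poly_map F (l *s a) = eval_poly_map F (u *s a)" for l u
  proof (rule ccontr)
    assume ne: "l *s a \<noteq> u *s a"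
    then have lu: "l \<noteq> u" by auto
    from ne obtain k where k: "a $ k \<noteq> 0"
      by (auto simp: vec_eq_iff)
    obtain c where c: "c \<noteq> 0" "det (jacobian_mat F) = const_mpoly c"
      using assms(1) by (auto simp: keller_map_def)
    define g :: "'k poly" where "g = monom (of_nat d) (d - 1) - [:(l ^ d - u ^ d) / (l - u):]"
    define A where "A = (\<chi> i j. line_poly a (jacobian_mat F $ i $ j))"
    define x where "x = (\<chi> j. [:a $ j:])"
    have det: "det A = [:c:]"
      unfolding A_def
      by (subst det_ring_hom) (simp_all add: line_poly_add line_poly_mult c const_mpoly_def monom_0)
    have "pderiv (line_poly a (F $ i)) = g * [:coeff (line_poly a (F $ i)) d:]" for i
      unfolding g_def
    proof (rule pderiv_3_terms_equal_values)
      show "coeff (line_poly a (F $ i)) n = 0" if "n \<notin> {0, 1, d}" for n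
        using assms(4) that by (intro coeff_line_poly_eq_0) (fastforce simp: poly_map_terms_def)
      show "poly (line_poly a (F $ i)) l = poly (line_poly a (F $ i)) u"
        using eq by (simp add: poly_line_poly eval_poly_map_def vec_eq_iff)
    qed (use assms(2) lu in auto)
    \<comment> \<open>By the chain rule, entry \<open>i\<close> of \<open>A *v x\<close> is the
      derivative of component \<open>i\<close> along the line.\<close>
    then have "A *v x = g *s (\<chi> i. [:coeff (line_poly a (F $ i)) d:])"
      by (simp add: vec_eq_iff A_def x_def jacobian_mat_def matrix_vector_mult_def
          del: mult_pCons_right flip: pderiv_line_poly)
    then have "g dvd x $ k * det A"
      by (rule dvd_mult_det)
    then have "g dvd [:a $ k * c:]"
      by (simp add: x_def det mult.commute)
    then have "degree g = 0"
      using k c(1) dvd_imp_degree_le[of g "[:a $ k * c:]"] by simp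
    \<comment> \<open>Since \<open>d - 1 > 0\<close>, the constant subtracted in \<open>g\<close>
      does not affect this coefficient, which is nonzero because \<open>d\<close> is a unit.\<close>
    moreover have "coeff g (d - 1) = of_nat d"
      using assms(2) by (simp add: g_def coeff_pCons split: nat.split)
    ultimately show False
      using assms(2,3) le_degree[of g "d - 1"] by simp
  qed
  then show ?thesis
    by (auto simp: inj_on_def)
qed

end
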